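(* Let $g:\mathbb{R}^n\to\mathbb{R}^n$ be Lipschitz continuous with a constant $\kappa<1$, let $x^*$ be the fixed point of $g$, let $g$ be differentiable at $x^*$, and suppose that $g$ satisfies $$\|g(x)-g(x^* )-g'(x^* )(x-x^* )\|=O(\|x-x^*\|^2)\quad\text{as }x\to x^*.$$ Let $\{x^k\}$ be generated by the regularized Anderson acceleration algorithm (LM-AA, described in the context) with regularization weight $\lambda_k=\mu_k\|f^{k_0}\|^4$, with stopping threshold $\epsilon_f=0$ and with $c\in(0,1)$ satisfying $c\ge\kappa$, and assume the algorithm does not terminate after finitely many steps. Suppose that for the solutions $\bar\alpha^k\in\operatorname{argmin}_{\alpha}\|\hat f^k(\alpha)\|^2$ of the unregularized problem there exists $M>0$ such that $\|\bar\alpha^k\|_\infty\le M$ for all $k$ sufficiently large. Then, for all $k$ sufficiently large, $$\|f^{k+1}\|\le\kappa\,\theta_k\|f^{k_0}\|+\sum_{i=0}^{m}O(\|f^{k-i}\|^2),$$ where $\theta_k:=\|\hat f^k(\bar\alpha^k)\|/\|f^{k_0}\|$.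
   Context: $\|\cdot\|$ is the Euclidean norm on $\mathbb{R}^n$, and $f(x):=g(x)-x$. The solution $\bar\alpha^k$ of the unregularized problem need not be unique; $\bar\alpha^k$ denotes a chosen solution for each $k$. The constants in the $O(\cdot)$ terms of the conclusion do not depend on $k$. LM-AA algorithm (with fourth-power weight). Input: a mapping $g:\mathbb{R}^n\to\mathbb{R}^n$ with residual $f(x)=g(x)-x$; a starting point $x^0\in\mathbb{R}^n$; a memory parameter $m\in\mathbb{N}$, $m\ge1$; constants $\mu_0>0$, $0<p_1<p_2<1$, $0<\eta_2<1<\eta_1$, $0<c<1$, $\gamma\in(0,\frac{1}{m+1})$. For $k=0,1,2,\dots$ perform the following steps. 1. Compute $g^k:=g(x^k)$ and $f^k:=f(x^k)=g^k-x^k$. With stopping threshold $\epsilon_f=0$: if $f^k=0$, terminate. 2. Let $m_k:=\min\{m,k\}$. Let $k_0$ be the largest index in $\{k,k-1,\dots,k-m_k\}$ at which $\|f^i\|$ is minimal over $i\in\{k,k-1,\dots,k-m_k\}$, and let $k_1,\dots,k_{m_k}$ be an enumeration of the remaining indices of $\{k,\dots,k-m_k\}$. 3. For $\alpha\in\mathbb{R}^{m_k}$ define $\hat f^k(\alpha):=f^{k_0}+\sum_{i=1}^{m_k}\alpha_i(f^{k_i}-f^{k_0})$ and $\hat g^k(\alpha):=g^{k_0}+\sum_{i=1}^{m_k}\alpha_i(g^{k_i}-g^{k_0})$ (for $k=0$ the sums are empty). 4. Set $\lambda_k:=\mu_k\|f^{k_0}\|^4$ and let $\alpha^k:=\operatorname{argmin}_{\alpha\in\mathbb{R}^{m_k}}\|\hat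 f^k(\alpha)\|^2+\lambda_k\|\alpha\|^2$. 5. Set $r_k:=(1-m_k\gamma)\|f^{k_0}\|+\gamma\sum_{i=1}^{m_k}\|f^{k_i}\|$, $\mathrm{ared}_k:=r_k-\|f(\hat g^k(\alpha^k))\|$, $\mathrm{pred}_k:=r_k-c\|\hat f^k(\alpha^k)\|$, and $\rho_k:=\mathrm{ared}_k/\mathrm{pred}_k$. 6. Set $\mu_{k+1}:=\eta_1\mu_k$ if $\rho_k<p_1$; $\mu_{k+1}:=\mu_k$ if $\rho_k\in[p_1,p_2]$; $\mu_{k+1}:=\eta_2\mu_k$ if $\rho_k>p_2$. 7. If $\rho_k\ge p_1$ (successful iteration), set $x^{k+1}:=\hat g^k(\alpha^k)$; otherwise set $x^{k+1}:=g^{k_0}=g(x^{k_0})$. *)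

theory Defs
  imports "HOL-Analysis.Analysis" "HOL-Library.Landau_Symbols"
begin

definition residual :: "('a \<Rightarrow> 'a) \<Rightarrow> 'a \<Rightarrow> 'a::ab_group_add" where
  "residual g x = g x - x"

text \<open>
  The dimension \<open>d = min m k\<close> of the coefficient vectors varies with the iteration, so
  \<open>\<real>\<^sup>d\<close> is the set of functions on \<open>{1..d}\<close> that are \<open>undefined\<close> outside.
\<close>

definition coeff_space :: "nat \<Rightarrow> (nat \<Rightarrow> real) set" where
  "coeff_space d = ({1..d} \<rightarrow>\<^sub>E UNIV)"

definition coeff_infnorm :: "nat \<Rightarrow> (nat \<Rightarrow> real) \<Rightarrow> real" where
  "coeff_infnorm d a = Max (insert 0 ((\<lambda>i. \<bar>a i\<bar>) ` {1..d}))"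

text \<open>
  With \<open>j i\<close> standing for the index \<open>k\<^sub>i\<close>, this is
  \<open>v\<^bsup>k\<^sub>0\<^esup> + (\<Sum>i=1..d. a\<^sub>i (v\<^bsup>k\<^sub>i\<^esup> - v\<^bsup>k\<^sub>0\<^esup>))\<close>; it gives both
  \<open>f\<close>-hat (for \<open>v\<close> the residuals) and \<open>g\<close>-hat (for \<open>v\<close> the values of \<open>g\<close>).
\<close>

definition mix :: "(nat \<Rightarrow> 'a::real_vector) \<Rightarrow> (nat \<Rightarrow> nat) \<Rightarrow> nat \<Rightarrow> (nat \<Rightarrow> real) \<Rightarrow> 'a" where
  "mix v j d a = v (j 0) + (\<Sum>i=1..d. a i *\<^sub>R (v (j i) - v (j 0)))"

definition fhat ::
  "('a \<Rightarrow> 'a) \<Rightarrow> nat \<Rightarrow> (nat \<Rightarrow> 'a) \<Rightarrow> (nat \<Rightarrow> nat \<Rightarrow> nat) \<Rightarrow> nat \<Rightarrow> (nat \<Rightarrow> real) \<Rightarrow> 'a::real_vector" where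
  "fhat g m x j k a = mix (\<lambda>i. residual g (x i)) (j k) (min m k) a"

definition ghat ::
  "('a \<Rightarrow> 'a) \<Rightarrow> nat \<Rightarrow> (nat \<Rightarrow> 'a) \<Rightarrow> (nat \<Rightarrow> nat \<Rightarrow> nat) \<Rightarrow> nat \<Rightarrow> (nat \<Rightarrow> real) \<Rightarrow> 'a::real_vector" where
  "ghat g m x j k a = mix (\<lambda>i. g (x i)) (j k) (min m k) a"

text \<open>
  Infinite runs of the method with the stopping test left out: a run in which the test
  never fires is one with \<open>residual g (x k) \<noteq> 0\<close> for all \<open>k\<close>.
  Here \<open>j k 0, \<dots>, j k (min m k)\<close> are the indices \<open>k\<^sub>0, \<dots>, k\<^bsub>m\<^sub>k\<^esub>\<close> of iteration \<open>k\<close>.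
\<close>

locale lm_aa =
  fixes g :: "real ^ 'n \<Rightarrow> real ^ 'n"
    and m :: nat
    and mu0 p1 p2 eta1 eta2 c gamma :: real
    and x :: "nat \<Rightarrow> real ^ 'n"
    and mu :: "nat \<Rightarrow> real"
    and j :: "nat \<Rightarrow> nat \<Rightarrow> nat"
    and alpha :: "nat \<Rightarrow> nat \<Rightarrow> real"
    and r ared pred rho :: "nat \<Rightarrow> real"
  assumes m: "m \<ge> 1"
    and mu0: "mu0 > 0"
    and p: "0 < p1" "p1 < p2" "p2 < 1"
    and eta: "0 < eta2" "eta2 < 1" "1 < eta1"
    and c: "0 < c" "c < 1"
    and gamma: "0 < gamma" "gamma < 1 / (real m + 1)"
    and mu_0: "mu 0 = mu0"
    and j_0: "\<And>k. j k 0 =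
      (GREATEST i. is_arg_min (\<lambda>i. norm (residual g (x i))) (\<lambda>i. i \<in> {k - min m k..k}) i)"
    and j_enum: "\<And>k. bij_betw (j k) {1..min m k} ({k - min m k..k} - {j k 0})"
    and alpha: "\<And>k. is_arg_min
      (\<lambda>a. (norm (fhat g m x j k a))\<^sup>2
            + (mu k * norm (residual g (x (j k 0))) ^ 4) * (L2_set a {1..min m k})\<^sup>2)
      (\<lambda>a. a \<in> coeff_space (min m k)) (alpha k)"
    and r: "\<And>k. r k = (1 - real (min m k) * gamma) * norm (residual g (x (j k 0)))
      + gamma * (\<Sum>i=1..min m k. norm (residual g (x (j k i))))"
    and ared: "\<And>k. ared k = r k - norm (residual g (ghat g m x j k (alpha k)))"
    and pred: "\<And>k. pred k = r k - c * norm (fhat g m x j k (alpha k))"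
    and rho: "\<And>k. rho k = ared k / pred k"
    and mu_Suc: "\<And>k. mu (Suc k) =
      (if rho k < p1 then eta1 * mu k else if rho k \<le> p2 then mu k else eta2 * mu k)"
    and x_Suc: "\<And>k. x (Suc k) =
      (if rho k \<ge> p1 then ghat g m x j k (alpha k) else g (x (j k 0)))"

end

theory Submission imports Defs begin

text \<open>
  Whether or not step \<open>k\<close> is successful, the next residual is at most a fixed factor below \<open>1\<close>
  times the largest residual in the memory window, so the residuals tend to \<open>0\<close>. The regularized
  coefficients are no longer than the unregularized ones, hence bounded, and expanding \<open>g\<close> at the
  fixed point shows that the residual at \<open>ghat\<close> is at most \<open>kappa * norm fhat\<close> up to an error
  quadratic in the window. As \<open>kappa \<le> c\<close>, this forces \<open>rho k > p2\<close> eventually: all steps become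
  successful and \<open>mu\<close> stays bounded. Then regularization with weight
  \<open>mu k * norm (residual g (x (j k 0))) ^ 4\<close> perturbs the minimum of \<open>norm fhat\<close> only quadratically.
\<close>

section \<open>Affine combinations with bounded coefficients\<close>

lemma mix_cong:
  assumes "\<And>i. i \<in> {1..d} \<Longrightarrow> a i = b i"
  shows "mix v j d a = mix v j d b"
  unfolding mix_def using assms by (intro arg_cong2 [where f = "(+)"] sum.cong) auto

lemma mix_zero: "mix v j d (\<lambda>_. 0) = v (j 0)"
  by (simp add: mix_def)

lemma mix_add: "mix (\<lambda>i. v i + w i) j d a = mix v j d a + mix w j d a"
proof -
  have "(\<Sum>i=1..d. a i *\<^sub>R (v (j i) + w (j i) - (v (j 0) + w (j 0)))) =
    (\<Sum>i=1..d. a i *\<^sub>R (v (j i) - v (j 0))) + (\<Sum>i=1..d. a i *\<^sub>R (w (j i) - w (j 0)))"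
    unfolding sum.distrib [symmetric] by (intro sum.cong) (auto simp: algebra_simps)
  then show ?thesis by (simp add: mix_def)
qed

lemma mix_const: "mix (\<lambda>_. u) j d a = u"
  by (simp add: mix_def)

lemma linear_mix:
  assumes "linear h"
  shows "h (mix v j d a) = mix (\<lambda>i. h (v i)) j d a"
  by (simp add: mix_def linear_add [OF assms] linear_diff [OF assms] linear_scale [OF assms]
      linear_sum [OF assms])

lemma mix_diff: "mix (\<lambda>i. v i - w i) j d a = mix v j d a - mix w j d a"
  using mix_add [of "\<lambda>i. v i - w i" w j d a] by simp

text \<open>The base vector contributes \<open>D\<close>; each of the \<open>d\<close> differences
  has norm at most \<open>2 * D\<close> and weight at most \<open>B\<close>.\<close>

lemma norm_mix_le:
  fixes v :: "nat \<Rightarrow> 'a::real_normed_vector"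
  assumes v: "\<And>i. i \<le> d \<Longrightarrow> norm (v (j i)) \<le> D"
    and a: "\<And>i. i \<in> {1..d} \<Longrightarrow> \<bar>a i\<bar> \<le> B"
  shows "norm (mix v j d a) \<le> (1 + 2 * real d * B) * D"
proof -
  have D: "norm (v (j 0)) \<le> D" using v by simp
  have "norm (a i *\<^sub>R (v (j i) - v (j 0))) \<le> B * (2 * D)" if i: "i \<in> {1..d}" for i
  proof -
    have "norm (v (j i) - v (j 0)) \<le> 2 * D"
      using norm_triangle_ineq4 [of "v (j i)" "v (j 0)"] v [of i] i D by simp
    then show ?thesis
      using a [OF i] by (simp add: mult_mono')
  qed
  then have "norm (\<Sum>i=1..d. a i *\<^sub>R (v (j i) - v (j 0))) \<le> (\<Sum>i=1..d. B * (2 * D))"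
    by (rule sum_norm_le)
  then have "norm (mix v j d a) \<le> D + real d * (B * (2 * D))"
    unfolding mix_def using D norm_triangle_mono by fastforce
  then show ?thesis by (simp add: algebra_simps)
qed

text \<open>
  The affine part of \<open>g\<close> commutes with affine combinations, so only the remainders survive.
\<close>

lemma norm_mix_image_diff_le:
  fixes g g' :: "'a::real_normed_vector \<Rightarrow> 'a"
  assumes lin: "linear g'"
    and R: "\<And>y. norm (y - u) < \<delta> \<Longrightarrow> norm (g y - g u - g' (y - u)) \<le> C * (norm (y - u))\<^sup>2"
    and x: "\<And>i. i \<le> d \<Longrightarrow> norm (x (j i) - u) \<le> E"
    and a: "\<And>i. i \<in> {1..d} \<Longrightarrow> \<bar>a i\<bar> \<le> B"
    and "0 \<le> B" "0 \<le> C" and small: "(1 + 2 * real d * B) * E < \<delta>"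
  shows "norm (g (mix x j d a) - mix (\<lambda>i. g (x i)) j d a)
    \<le> C * ((1 + 2 * real d * B)\<^sup>2 + (1 + 2 * real d * B)) * E\<^sup>2"
proof -
  define K where "K = 1 + 2 * real d * B"
  define R' where "R' y = g y - g u - g' (y - u)" for y
  define y where "y = mix x j d a"
  have K: "K \<ge> 1" using \<open>0 \<le> B\<close> by (simp add: K_def)
  have "0 \<le> E" using x [of 0] norm_ge_zero order_trans by blast
  \<comment> \<open>Since \<open>K \<ge> 1\<close>, the smallness assumption places not only the
    mixed point but also every \<open>x (j i)\<close> in the ball where \<open>R\<close>
    applies.\<close>
  then have "E \<le> K * E" using K by (simp add: mult_le_cancel_right1)
  then have E: "E < \<delta>" using small by (simp add: K_def)
  have yu: "y - u = mix (\<lambda>i. x i - u) j d a"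
    by (simp add: mix_diff mix_const y_def)
  have "(\<lambda>i. g (x i)) = (\<lambda>i. (g u + g' (x i - u)) + R' (x i))"
    by (simp add: R'_def)
  then have "mix (\<lambda>i. g (x i)) j d a = g u + g' (y - u) + mix (\<lambda>i. R' (x i)) j d a"
    by (simp add: mix_add mix_const linear_mix [OF lin] yu)
  then have eq: "g y - mix (\<lambda>i. g (x i)) j d a = R' y - mix (\<lambda>i. R' (x i)) j d a"
    by (simp add: R'_def)
  have nyu: "norm (y - u) \<le> K * E"
    unfolding yu K_def by (rule norm_mix_le) (use x a in auto)
  then have "norm (R' y) \<le> C * (norm (y - u))\<^sup>2"
    unfolding R'_def using small by (intro R) (simp add: K_def)
  also have "\<dots> \<le> C * (K * E)\<^sup>2"
    using nyu \<open>0 \<le> C\<close> by (intro mult_left_mono power_mono) auto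
  finally have 1: "norm (R' y) \<le> C * (K * E)\<^sup>2" .
  have "norm (R' (x (j i))) \<le> C * E\<^sup>2" if "i \<le> d" for i
  proof -
    have "norm (R' (x (j i))) \<le> C * (norm (x (j i) - u))\<^sup>2"
      unfolding R'_def using x [OF that] E by (intro R) simp
    also have "\<dots> \<le> C * E\<^sup>2"
      using x [OF that] \<open>0 \<le> C\<close> by (intro mult_left_mono power_mono) auto
    finally show ?thesis .
  qed
  then have 2: "norm (mix (\<lambda>i. R' (x i)) j d a) \<le> K * (C * E\<^sup>2)"
    unfolding K_def by (intro norm_mix_le) (use a in auto)
  \<comment> \<open>The first term is the remainder at the mixed point, the second the mixture of
    the remainders at the \<open>x (j i)\<close>.\<close>
  have "norm (g y - mix (\<lambda>i. g (x i)) j d a) \<le> C * (K * E)\<^sup>2 + K * (C * E\<^sup>2)"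
    unfolding eq using 1 2 norm_triangle_ineq4 by (smt (verit))
  then show ?thesis
    unfolding K_def [symmetric] y_def by (simp add: algebra_simps power_mult_distrib)
qed

section \<open>Fixed-point distance, remainders and coefficient norms\<close>

text \<open>Follows from \<open>y - u = (g y - g u) - residual g y\<close>. It lets residuals
  measure the distance to the fixed point.\<close>

lemma residual_lower_bound:
  fixes g :: "'a::real_normed_vector \<Rightarrow> 'a"
  assumes "L-lipschitz_on UNIV g" "g u = u"
  shows "(1 - L) * norm (y - u) \<le> norm (residual g y)"
proof -
  have "norm (g y - g u) \<le> L * norm (y - u)"
    using lipschitz_onD [OF assms(1), of y u] by (simp add: dist_norm)
  moreover have "norm (y - u) \<le> norm (g y - g u) + norm (residual g y)"
    using norm_triangle_ineq4 [of "g y - g u" "residual g y"] assms(2) by (simp add: residual_def)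
  ultimately show ?thesis by (simp add: algebra_simps)
qed

text \<open>The filter \<open>at u\<close> says nothing about \<open>u\<close> itself;
  \<open>h u = 0\<close> closes this gap, so the bound holds on a full ball. A mixed point could
  coincide with \<open>u\<close>.\<close>

lemma bigo_at_bound:
  fixes h b :: "'a::metric_space \<Rightarrow> real"
  assumes "h \<in> O[at u](b)" "h u = 0"
  obtains C \<delta> where "C > 0" "\<delta> > 0" "\<And>y. dist y u < \<delta> \<Longrightarrow> \<bar>h y\<bar> \<le> C * \<bar>b y\<bar>"
proof -
  from assms(1) obtain C where C: "C > 0" "\<forall>\<^sub>F y in at u. norm (h y) \<le> C * norm (b y)"
    by (elim landau_o.bigE)
  then obtain \<delta> where "\<delta> > 0" "\<forall>y. y \<noteq> u \<and> dist y u < \<delta> \<longrightarrow> norm (h y) \<le> C * norm (b y)"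
    unfolding eventually_at by auto
  with C show ?thesis
    by (intro that [of C \<delta>]) (use assms(2) in force)+
qed

lemma coeff_infnorm_ge: "i \<in> {1..d} \<Longrightarrow> \<bar>a i\<bar> \<le> coeff_infnorm d a"
  unfolding coeff_infnorm_def by (intro Max_ge) auto

lemma L2_set_le_coeff_infnorm: "L2_set a {1..d} \<le> real d * coeff_infnorm d a"
proof -
  have "L2_set a {1..d} \<le> (\<Sum>i=1..d. \<bar>a i\<bar>)" by (rule L2_set_le_sum_abs)
  also have "\<dots> \<le> (\<Sum>i=1..d. coeff_infnorm d a)"
    by (intro sum_mono coeff_infnorm_ge)
  finally show ?thesis by simp
qed

lemma abs_le_L2_set: "finite A \<Longrightarrow> i \<in> A \<Longrightarrow> \<bar>a i\<bar> \<le> L2_set a A"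
  using member_le_L2_set [of A i "\<lambda>i. \<bar>a i\<bar>"] by (simp add: L2_set_def)

text \<open>Windowed contraction forces geometric decay with rate \<open>q\<^bsup>1/(m+1)\<^esup>\<close>.\<close>

lemma windowed_contraction_tendsto_0:
  fixes F :: "nat \<Rightarrow> real"
  assumes nonneg: "\<And>k. 0 \<le> F k" and q: "0 < q" "q < 1"
    and step: "\<And>k D. (\<And>i. i \<in> {k - m..k} \<Longrightarrow> F i \<le> D) \<Longrightarrow> F (Suc k) \<le> q * D"
  shows "F \<longlonglongrightarrow> 0"
proof -
  define s where "s = root (Suc m) q"
  have s: "0 < s" "s < 1" "s ^ Suc m = q"
    using q by (simp_all add: s_def del: power_Suc)
  have bound: "F k \<le> F 0 * s ^ k" for k
  proof (induction k rule: less_induct)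
    case (less k)
    show ?case
    proof (cases k)
      case (Suc n)
      have "F i \<le> F 0 * s ^ (n - m)" if "i \<in> {n - m..n}" for i
      proof -
        have "F i \<le> F 0 * s ^ i" using less Suc that by simp
        also have "\<dots> \<le> F 0 * s ^ (n - m)"
          using that s nonneg by (intro mult_left_mono power_decreasing) auto
        finally show ?thesis .
      qed
      then have "F k \<le> q * (F 0 * s ^ (n - m))" using step Suc by blast
      also have "\<dots> = F 0 * s ^ (Suc m + (n - m))"
        by (simp add: power_add s(3) [symmetric])
      \<comment> \<open>Here \<open>k = Suc n\<close>. For \<open>n < m\<close> the truncated
        \<open>n - m\<close> is \<open>0\<close> and the exponent exceeds \<open>k\<close>, which is
        harmless because \<open>s < 1\<close>.\<close>
      also have "\<dots> \<le> F 0 * s ^ k"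
        using s nonneg Suc by (intro mult_left_mono power_decreasing) auto
      finally show ?thesis .
    qed simp
  qed
  have "(\<lambda>k. F 0 * s ^ k) \<longlonglongrightarrow> 0"
    using LIMSEQ_realpow_zero [of s] s tendsto_mult_right_zero by fastforce
  then show ?thesis
    using tendsto_sandwich [of "\<lambda>_. 0" F sequentially "\<lambda>k. F 0 * s ^ k" 0] nonneg bound by simp
qed

context lm_aa
begin

abbreviation F :: "nat \<Rightarrow> real" where
  "F i \<equiv> norm (residual g (x i))"

section \<open>The memory window and the reference value \<open>r\<close>\<close>

text \<open>\<open>GREATEST\<close> is meaningful here: the finite window has a minimizer, and all
  its minimizers are at most \<open>k\<close>. Truncated subtraction turns
  \<open>k - min m k\<close> into \<open>k - m\<close>.\<close>

lemma j_0_arg_min: "is_arg_min F (\<lambda>i. i \<in> {k - m..k}) (j k 0)"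
proof -
  have eq: "k - min m k = k - m" by simp
  obtain i where "is_arg_min F (\<lambda>i. i \<in> {k - m..k}) i"
    using ex_is_arg_min_if_finite [of "{k - m..k}" F] by auto
  then show ?thesis
    unfolding j_0 [of k] eq by (rule GreatestI_nat [where b = k]) (auto simp: is_arg_min_def)
qed

lemma F_j_0_le: "i \<in> {k - m..k} \<Longrightarrow> F (j k 0) \<le> F i"
  using j_0_arg_min [of k] unfolding is_arg_min_def by fastforce

lemma j_image: "j k ` {..min m k} = {k - m..k}"
proof -
  have eq: "k - min m k = k - m" by simp
  have "{..min m k} = insert 0 {1..min m k}" by auto
  moreover have "j k ` {1..min m k} = {k - m..k} - {j k 0}"
    using j_enum [of k] unfolding eq bij_betw_def by blast
  moreover have "j k 0 \<in> {k - m..k}"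
    using j_0_arg_min [of k] unfolding is_arg_min_def by blast
  ultimately show ?thesis by auto
qed

lemma j_in_window: "i \<le> min m k \<Longrightarrow> j k i \<in> {k - m..k}"
  using j_image [of k] by blast

text \<open>This is what \<open>gamma < 1 / (m + 1)\<close> provides: the weight of
  \<open>k_0\<close> in \<open>r k\<close> is no smaller than the other weights.\<close>

lemma gamma_weights: "gamma \<le> 1 - real (min m k) * gamma"
proof -
  have "(real (min m k) + 1) * gamma \<le> (real m + 1) * gamma"
    using gamma by (intro mult_right_mono) auto
  also have "\<dots> \<le> 1" using gamma(2) by (simp add: field_simps)
  finally show ?thesis by (simp add: algebra_simps)
qed

text \<open>The weights in \<open>r k\<close> sum to \<open>1\<close>, and \<open>F (j k 0)\<close>
  is the smallest residual in the window.\<close>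

lemma r_ge_F_j_0: "F (j k 0) \<le> r k"
proof -
  have "gamma * (\<Sum>i=1..min m k. F (j k 0)) \<le> gamma * (\<Sum>i=1..min m k. F (j k i))"
    using gamma F_j_0_le j_in_window by (intro mult_left_mono sum_mono) auto
  then show ?thesis unfolding r by (simp add: algebra_simps)
qed

lemma r_le:
  assumes "\<And>i. i \<in> {k - m..k} \<Longrightarrow> F i \<le> D"
  shows "r k \<le> D"
proof -
  have F: "F (j k i) \<le> D" if "i \<le> min m k" for i
    using assms j_in_window that by blast
  then have "(1 - real (min m k) * gamma) * F (j k 0) \<le> (1 - real (min m k) * gamma) * D"
    using gamma_weights [of k] gamma(1) by (auto intro: mult_left_mono)
  moreover have "gamma * (\<Sum>i=1..min m k. F (j k i)) \<le> gamma * (\<Sum>i=1..min m k. D)"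
    using F gamma(1) by (intro mult_left_mono sum_mono) auto
  ultimately show ?thesis unfolding r by (simp add: algebra_simps)
qed

text \<open>Each residual of the window enters \<open>r k\<close> with weight at least
  \<open>gamma\<close>, and the other terms are nonnegative. This makes \<open>r k\<close>
  comparable to the largest residual.\<close>

lemma r_ge_gamma_F:
  assumes "i \<in> {k - m..k}"
  shows "gamma * F i \<le> r k"
proof -
  obtain l where l: "l \<le> min m k" "i = j k l" using assms j_image [of k] by blast
  have *: "gamma * F (j k 0) \<le> (1 - real (min m k) * gamma) * F (j k 0)"
    using gamma_weights by (intro mult_right_mono) auto
  have nn: "0 \<le> gamma * (\<Sum>i=1..min m k. F (j k i))" "0 \<le> gamma * F (j k 0)"
    using gamma by (auto intro!: mult_nonneg_nonneg sum_nonneg)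
  show ?thesis
  proof (cases "l = 0")
    case True
    then show ?thesis using * nn l unfolding r by simp
  next
    case False
    then have "F i \<le> (\<Sum>i=1..min m k. F (j k i))"
      unfolding l(2) using l(1) by (intro member_le_sum [where f = "\<lambda>i. F (j k i)"]) auto
    then have "gamma * F i \<le> gamma * (\<Sum>i=1..min m k. F (j k i))"
      using gamma by (intro mult_left_mono) auto
    then show ?thesis using * nn(2) unfolding r by linarith
  qed
qed

section \<open>Optimality of the coefficients and its consequences\<close>

lemma mu_pos: "mu k > 0"
  using mu0 eta by (induction k) (auto simp: mu_0 mu_Suc)

lemma alpha_le:
  assumes "a \<in> coeff_space (min m k)"
  shows "(norm (fhat g m x j k (alpha k)))\<^sup>2 + mu k * F (j k 0) ^ 4 * (L2_set (alpha k) {1..min m k})\<^sup>2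
    \<le> (norm (fhat g m x j k a))\<^sup>2 + mu k * F (j k 0) ^ 4 * (L2_set a {1..min m k})\<^sup>2"
  using alpha [of k] assms unfolding is_arg_min_def by (meson not_le)

lemma fhat_alpha_le: "norm (fhat g m x j k (alpha k)) \<le> F (j k 0)"
proof -
  \<comment> \<open>Zero coefficients as competitor, restricted because members of
    \<open>coeff_space\<close> are \<open>undefined\<close> outside the index range.\<close>
  let ?z = "\<lambda>i\<in>{1..min m k}. 0 :: real"
  have z: "?z \<in> coeff_space (min m k)" by (simp add: coeff_space_def)
  have "L2_set ?z {1..min m k} = 0" by (simp add: L2_set_def)
  moreover have "fhat g m x j k ?z = residual g (x (j k 0))"
    unfolding fhat_def
    using mix_cong [of "min m k" ?z "\<lambda>_. 0" "\<lambda>i. residual g (x i)" "j k"] by (simp add: mix_zero)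
  ultimately have "(norm (fhat g m x j k (alpha k)))\<^sup>2
      + mu k * F (j k 0) ^ 4 * (L2_set (alpha k) {1..min m k})\<^sup>2 \<le> (F (j k 0))\<^sup>2"
    using alpha_le [OF z] by simp
  moreover have "0 \<le> mu k * F (j k 0) ^ 4 * (L2_set (alpha k) {1..min m k})\<^sup>2"
    using mu_pos [of k] by (simp add: less_imp_le)
  ultimately have "(norm (fhat g m x j k (alpha k)))\<^sup>2 \<le> (F (j k 0))\<^sup>2" by linarith
  then show ?thesis by (rule power2_le_imp_le) simp
qed

text \<open>From \<open>norm fhat \<le> F (j k 0) \<le> r k\<close>. As \<open>c < 1\<close>, it
  yields \<open>pred k > 0\<close> whenever \<open>r k > 0\<close>, so bounds on
  \<open>rho k\<close> become bounds on \<open>ared k\<close>.\<close>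

lemma pred_ge: "(1 - c) * r k \<le> pred k"
proof -
  have "c * norm (fhat g m x j k (alpha k)) \<le> c * r k"
    using fhat_alpha_le r_ge_F_j_0 c by (intro mult_left_mono) (auto intro: order_trans)
  then show ?thesis unfolding pred by (simp add: algebra_simps)
qed

lemma successful_F_Suc_le:
  assumes "rho k \<ge> p1" "pred k > 0"
  shows "F (Suc k) \<le> (1 - p1 * (1 - c)) * r k"
proof -
  have "p1 * pred k \<le> ared k"
    using assms unfolding rho by (simp add: field_simps)
  moreover have "p1 * ((1 - c) * r k) \<le> p1 * pred k"
    using pred_ge p by (intro mult_left_mono) auto
  moreover have "ared k = r k - F (Suc k)"
    unfolding ared x_Suc using assms by simp
  ultimately show ?thesis by (simp add: algebra_simps)
qed

text \<open>\<open>b\<close> already minimizes the first term of the regularized objective, so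
  \<open>alpha k\<close> can only win through the penalty; the nonzero residual makes the penalty
  weight positive.\<close>

lemma L2_set_alpha_le:
  assumes "is_arg_min (\<lambda>a. (norm (fhat g m x j k a))\<^sup>2) (\<lambda>a. a \<in> coeff_space (min m k)) b"
    and "F (j k 0) \<noteq> 0"
  shows "L2_set (alpha k) {1..min m k} \<le> L2_set b {1..min m k}"
proof -
  have "alpha k \<in> coeff_space (min m k)" using alpha [of k] by (simp add: is_arg_min_def)
  then have "(norm (fhat g m x j k b))\<^sup>2 \<le> (norm (fhat g m x j k (alpha k)))\<^sup>2"
    using assms(1) unfolding is_arg_min_def by (meson not_le)
  moreover have "b \<in> coeff_space (min m k)" using assms(1) by (simp add: is_arg_min_def)
  ultimately have "mu k * F (j k 0) ^ 4 * (L2_set (alpha k) {1..min m k})\<^sup>2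
      \<le> mu k * F (j k 0) ^ 4 * (L2_set b {1..min m k})\<^sup>2"
    using alpha_le [of b k] by linarith
  moreover have "0 < mu k * F (j k 0) ^ 4" using mu_pos [of k] assms(2) by simp
  ultimately have "(L2_set (alpha k) {1..min m k})\<^sup>2 \<le> (L2_set b {1..min m k})\<^sup>2"
    using mult_le_cancel_left_pos by blast
  then show ?thesis by (rule power2_le_imp_le) simp
qed

text \<open>Testing the regularized objective at \<open>b\<close> gives
  \<open>?A\<^sup>2 \<le> ?B\<^sup>2 + ?C\<^sup>2\<close>. The square root turns the fourth power in
  the weight into a quadratic error.\<close>

lemma fhat_alpha_le_fhat:
  assumes "b \<in> coeff_space (min m k)"
  shows "norm (fhat g m x j k (alpha k))
    \<le> norm (fhat g m x j k b) + sqrt (mu k) * (F (j k 0))\<^sup>2 * L2_set b {1..min m k}"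
    (is "?A \<le> ?B + ?C")
proof (rule power2_le_imp_le)
  have C: "0 \<le> ?C" using mu_pos [of k] by (simp add: less_imp_le)
  show "0 \<le> ?B + ?C" using C by simp
  have "?C\<^sup>2 = mu k * F (j k 0) ^ 4 * (L2_set b {1..min m k})\<^sup>2"
    using mu_pos [of k] by (simp add: power_mult_distrib less_imp_le flip: power_mult)
  moreover have "0 \<le> mu k * F (j k 0) ^ 4 * (L2_set (alpha k) {1..min m k})\<^sup>2"
    using mu_pos [of k] by (simp add: less_imp_le)
  ultimately have "?A\<^sup>2 \<le> ?B\<^sup>2 + ?C\<^sup>2" using alpha_le [OF assms] by linarith
  also have "\<dots> \<le> (?B + ?C)\<^sup>2" using C by (simp add: power2_sum)
  finally show "?A\<^sup>2 \<le> (?B + ?C)\<^sup>2" .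
qed

text \<open>The mixture of the iterates differs from \<open>ghat\<close> by exactly
  \<open>fhat\<close>, which \<open>g\<close> contracts; the last term measures how far
  \<open>g\<close> fails to commute with mixing.\<close>

lemma norm_residual_ghat_le:
  assumes "kappa-lipschitz_on UNIV g"
  shows "norm (residual g (ghat g m x j k a)) \<le> kappa * norm (fhat g m x j k a)
    + norm (g (mix x (j k) (min m k) a) - ghat g m x j k a)"
proof -
  let ?y = "mix x (j k) (min m k) a" and ?z = "ghat g m x j k a"
  have "?z - ?y = fhat g m x j k a"
    by (simp add: ghat_def fhat_def residual_def mix_diff)
  then have "norm (g ?z - g ?y) \<le> kappa * norm (fhat g m x j k a)"
    using lipschitz_onD [OF assms, of ?z ?y] by (simp add: dist_norm)
  moreover have "residual g ?z = (g ?z - g ?y) + (g ?y - ?z)" by (simp add: residual_def)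
  ultimately show ?thesis
    using norm_triangle_ineq [of "g ?z - g ?y" "g ?y - ?z"] by simp
qed

section \<open>Convergence of the residuals\<close>

lemma F_tendsto_0:
  assumes lip: "kappa-lipschitz_on UNIV g" and "kappa < 1" and nz: "\<And>k. F k \<noteq> 0"
  shows "F \<longlonglongrightarrow> 0"
proof -
  \<comment> \<open>The two factors belong to successful steps, by the acceptance test, and to
    rejected steps, which are plain fixed-point steps from \<open>x (j k 0)\<close>.\<close>
  define q where "q = max (1 - p1 * (1 - c)) kappa"
  have "p1 * (1 - c) < 1 * 1" using p c by (intro mult_strict_mono) auto
  then have q: "0 < q" "q < 1" using p c \<open>kappa < 1\<close> by (auto simp: q_def)
  have "F (Suc k) \<le> q * D" if D: "\<And>i. i \<in> {k - m..k} \<Longrightarrow> F i \<le> D" for k D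
  proof -
    have rD: "r k \<le> D" using r_le D by blast
    have F0: "0 < F (j k 0)" using nz by simp
    then have r_pos: "0 < r k" using r_ge_F_j_0 [of k] by linarith
    have "F (Suc k) \<le> q * r k"
    proof (cases "rho k \<ge> p1")
      case True
      have "0 < (1 - c) * r k" using c r_pos by simp
      then have "pred k > 0" using pred_ge [of k] by linarith
      then have "F (Suc k) \<le> (1 - p1 * (1 - c)) * r k" using successful_F_Suc_le True by blast
      also have "\<dots> \<le> q * r k" using r_pos by (intro mult_right_mono) (auto simp: q_def)
      finally show ?thesis .
    next
      case False
      then have "F (Suc k) = norm (g (g (x (j k 0))) - g (x (j k 0)))"
        by (simp add: x_Suc residual_def)
      also have "\<dots> \<le> kappa * F (j k 0)"
        using lipschitz_onD [OF lip] by (simp add: dist_norm residual_def)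
      also have "\<dots> \<le> q * r k"
        using r_ge_F_j_0 q F0 by (intro mult_mono) (auto simp: q_def)
      finally show ?thesis .
    qed
    also have "\<dots> \<le> q * D" using q rD by simp
    finally show ?thesis .
  qed
  then show ?thesis
    using windowed_contraction_tendsto_0 [of F q m] q by simp
qed

section \<open>The largest residual in the window and the quadratic error\<close>

definition window_max :: "nat \<Rightarrow> real" where
  "window_max k = Max (F ` {k - m..k})"

lemma F_le_window_max: "i \<in> {k - m..k} \<Longrightarrow> F i \<le> window_max k"
  unfolding window_max_def by (intro Max_ge) auto

lemma window_max_attained: obtains i where "i \<in> {k - m..k}" "window_max k = F i"
proof -
  have "window_max k \<in> F ` {k - m..k}" unfolding window_max_def by (intro Max_in) auto
  then show ?thesis using that by blast
qed

lemma window_max_nonneg: "0 \<le> window_max k"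
  by (rule window_max_attained [of k]) simp

lemma window_max_square_le:
  assumes "m \<le> k"
  shows "(window_max k)\<^sup>2 \<le> (\<Sum>i=0..m. (F (k - i))\<^sup>2)"
proof -
  obtain i where i: "i \<in> {k - m..k}" "window_max k = F i"
    by (rule window_max_attained)
  have "(F (k - (k - i)))\<^sup>2 \<le> (\<Sum>i=0..m. (F (k - i))\<^sup>2)"
    using i(1) by (intro member_le_sum [where f = "\<lambda>i. (F (k - i))\<^sup>2"]) auto
  then show ?thesis using i by simp
qed

lemma eventually_window_max_less:
  assumes "F \<longlonglongrightarrow> 0" "0 < \<epsilon>"
  shows "\<forall>\<^sub>F k in sequentially. window_max k < \<epsilon>"
proof -
  have "\<forall>\<^sub>F k in sequentially. F k < \<epsilon>" using assms by (rule order_tendstoD)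
  then obtain N where N: "\<And>i. i \<ge> N \<Longrightarrow> F i < \<epsilon>" by (auto simp: eventually_sequentially)
  \<comment> \<open>The shift by \<open>m\<close> puts the whole window past
    \<open>N\<close>.\<close>
  have "window_max k < \<epsilon>" if "k \<ge> N + m" for k
  proof -
    obtain i where i: "i \<in> {k - m..k}" "window_max k = F i" by (rule window_max_attained)
    then have "N \<le> i" using that by auto
    then show ?thesis using N i(2) by simp
  qed
  then show ?thesis unfolding eventually_sequentially by blast
qed

text \<open>Window points lie within \<open>window_max k / (1 - kappa)\<close> of \<open>u\<close>,
  so for bounded coefficients the commutation error of \<open>g\<close> with mixing is quadratic in
  \<open>window_max k\<close>.\<close>

lemma residual_ghat_expansion:
  assumes lip: "kappa-lipschitz_on UNIV g" and kappa: "kappa < 1"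
    and fixpoint: "g u = u" and lin: "linear g'"
    and expansion: "(\<lambda>y. norm (g y - g u - g' (y - u))) \<in> O[at u](\<lambda>y. (norm (y - u))\<^sup>2)"
    and F0: "F \<longlonglongrightarrow> 0" and B: "0 \<le> B"
    and a: "\<forall>\<^sub>F k in sequentially. \<forall>i\<in>{1..min m k}. \<bar>a k i\<bar> \<le> B"
  obtains C where "0 \<le> C"
    "\<forall>\<^sub>F k in sequentially. norm (residual g (ghat g m x j k (a k)))
      \<le> kappa * norm (fhat g m x j k (a k)) + C * (window_max k)\<^sup>2"
proof -
  obtain C \<delta> where C: "C > 0" "\<delta> > 0"
    and R: "\<And>y. dist y u < \<delta> \<Longrightarrow>
      \<bar>norm (g y - g u - g' (y - u))\<bar> \<le> C * \<bar>(norm (y - u))\<^sup>2\<bar>"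
    by (rule bigo_at_bound [OF expansion]) (simp_all add: linear_0 [OF lin])
  define K where "K = 1 + 2 * real m * B"
  define C' where "C' = C * (K\<^sup>2 + K) / (1 - kappa)\<^sup>2"
  have K: "K \<ge> 1" using B by (simp add: K_def)
  \<comment> \<open>The threshold is what \<open>K * E < \<delta>\<close> requires for
    \<open>E = window_max k / (1 - kappa)\<close>.\<close>
  have "\<forall>\<^sub>F k in sequentially. window_max k < \<delta> * (1 - kappa) / K"
    using F0 by (rule eventually_window_max_less) (use C K kappa in simp)
  then have "\<forall>\<^sub>F k in sequentially. norm (residual g (ghat g m x j k (a k)))
      \<le> kappa * norm (fhat g m x j k (a k)) + C' * (window_max k)\<^sup>2"
    using a eventually_ge_at_top [of m]
  proof eventually_elim
    case (elim k)
    then have mk: "min m k = m" by simp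
    define E where "E = window_max k / (1 - kappa)"
    have E: "norm (x (j k i) - u) \<le> E" if "i \<le> m" for i
    proof -
      have "(1 - kappa) * norm (x (j k i) - u) \<le> window_max k"
        using residual_lower_bound [OF lip fixpoint, of "x (j k i)"]
          F_le_window_max [of "j k i" k] j_in_window [of i k] that mk by force
      then show ?thesis using kappa by (simp add: E_def field_simps)
    qed
    have "K * E < \<delta>"
      using elim(1) K kappa by (simp add: E_def field_simps)
    then have "norm (g (mix x (j k) m (a k)) - mix (\<lambda>i. g (x i)) (j k) m (a k))
      \<le> C * ((1 + 2 * real m * B)\<^sup>2 + (1 + 2 * real m * B)) * E\<^sup>2"
      using E elim(2) B C(1)
      by (intro norm_mix_image_diff_le [OF lin, where u = u and \<delta> = \<delta>])
        (use R in \<open>auto simp: K_def mk dist_norm\<close>)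
    also have "\<dots> = C' * (window_max k)\<^sup>2"
      by (simp add: C'_def E_def K_def power_divide)
    finally have "norm (g (mix x (j k) (min m k) (a k)) - ghat g m x j k (a k))
      \<le> C' * (window_max k)\<^sup>2"
      by (simp add: ghat_def mk)
    then show ?case
      using norm_residual_ghat_le [OF lip, of k "a k"] by linarith
  qed
  moreover have "0 \<le> C'" using C K by (simp add: C'_def)
  ultimately show ?thesis using that by blast
qed

text \<open>
  The predicted reduction is at least a fixed multiple of the largest residual in the window,
  so a quadratic error drives \<open>rho k\<close> to at least \<open>1\<close> in the limit.
\<close>

lemma eventually_rho_gt_p2:
  assumes F0: "F \<longlonglongrightarrow> 0" and nz: "\<And>k. F k \<noteq> 0" and "kappa \<le> c" and C: "0 \<le> C"
    and bound: "\<forall>\<^sub>F k in sequentially. norm (residual g (ghat g m x j k (alpha k)))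
      \<le> kappa * norm (fhat g m x j k (alpha k)) + C * (window_max k)\<^sup>2"
  shows "\<forall>\<^sub>F k in sequentially. p2 < rho k"
proof -
  \<comment> \<open>Chosen so that \<open>C * (window_max k)\<^sup>2\<close> stays below
    \<open>(1 - p2) * pred k\<close>; \<open>C + 1\<close> avoids a zero denominator.\<close>
  define \<epsilon> where "\<epsilon> = (1 - p2) * ((1 - c) * gamma) / (C + 1)"
  have "0 < \<epsilon>" using p c gamma C by (simp add: \<epsilon>_def)
  from eventually_window_max_less [OF F0 this] bound show ?thesis
  proof eventually_elim
    case (elim k)
    obtain i where i: "i \<in> {k - m..k}" "window_max k = F i" by (rule window_max_attained)
    have W: "0 < window_max k" using i nz by simp
    have "(1 - c) * (gamma * window_max k) \<le> (1 - c) * r k"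
      using r_ge_gamma_F [OF i(1)] i(2) c by simp
    then have pred: "(1 - c) * gamma * window_max k \<le> pred k"
      using pred_ge [of k] by simp
    have "0 < (1 - c) * gamma * window_max k" using c gamma W by simp
    then have pred_pos: "0 < pred k" using pred by linarith
    \<comment> \<open>\<open>kappa \<le> c\<close> enters here: \<open>ared k - pred k\<close> is
      \<open>c * norm fhat\<close> minus the residual at \<open>ghat\<close>.\<close>
    have "kappa * norm (fhat g m x j k (alpha k)) \<le> c * norm (fhat g m x j k (alpha k))"
      using \<open>kappa \<le> c\<close> by (intro mult_right_mono) auto
    then have *: "pred k - C * (window_max k)\<^sup>2 \<le> ared k"
      using elim(2) unfolding ared lm_aa.pred [OF lm_aa_axioms] by linarith
    have "C * window_max k \<le> (C + 1) * window_max k" using W by simp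
    also have "\<dots> < (1 - p2) * ((1 - c) * gamma)"
      using elim(1) C by (simp add: \<epsilon>_def field_simps)
    finally have "C * window_max k * window_max k < (1 - p2) * ((1 - c) * gamma) * window_max k"
      using W by (rule mult_strict_right_mono)
    also have "\<dots> \<le> (1 - p2) * pred k"
      using pred p by (simp add: mult.assoc)
    finally have "C * (window_max k)\<^sup>2 < (1 - p2) * pred k"
      by (simp add: power2_eq_square mult.assoc)
    with * have "p2 * pred k < ared k" by (simp add: algebra_simps)
    then show ?case unfolding rho using pred_pos by (simp add: field_simps)
  qed
qed

text \<open>Once \<open>rho k > p2\<close> holds permanently, every update multiplies
  \<open>mu\<close> by \<open>eta2 < 1\<close>.\<close>

lemma eventually_mu_bounded:
  assumes "\<forall>\<^sub>F k in sequentially. p2 < rho k"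
  obtains b where "\<forall>\<^sub>F k in sequentially. mu k \<le> b"
proof -
  obtain N where N: "\<And>k. k \<ge> N \<Longrightarrow> p2 < rho k"
    using assms by (auto simp: eventually_sequentially)
  have "mu k \<le> mu N" if "k \<ge> N" for k
    using that
  proof (induction k rule: dec_induct)
    case (step k)
    have "mu (Suc k) = eta2 * mu k" using N [OF step(1)] p by (simp add: mu_Suc)
    also have "\<dots> \<le> mu k" using eta mu_pos [of k] by simp
    finally show ?case using step by simp
  qed simp
  then show ?thesis using that eventually_sequentially by blast
qed

end

section \<open>The residual estimate with quadratic error\<close>

theorem corollary1:
  fixes g g' :: "real ^ 'n \<Rightarrow> real ^ 'n"
    and kappa M :: real
    and xstar :: "real ^ 'n"
    and m :: nat
    and mu0 p1 p2 eta1 eta2 c gamma :: real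
    and x :: "nat \<Rightarrow> real ^ 'n"
    and mu :: "nat \<Rightarrow> real"
    and j :: "nat \<Rightarrow> nat \<Rightarrow> nat"
    and alpha alpha_bar :: "nat \<Rightarrow> nat \<Rightarrow> real"
    and r ared pred rho theta :: "nat \<Rightarrow> real"
  assumes lipschitz: "kappa-lipschitz_on UNIV g" and "kappa < 1"
    and fixpoint: "g xstar = xstar"
    and deriv: "(g has_derivative g') (at xstar)"
    and expansion: "(\<lambda>y. norm (g y - g xstar - g' (y - xstar))) \<in> O[at xstar](\<lambda>y. (norm (y - xstar))\<^sup>2)"
    and run: "lm_aa g m mu0 p1 p2 eta1 eta2 c gamma x mu j alpha r ared pred rho"
    and "kappa \<le> c"
    and no_termination: "\<And>k. residual g (x k) \<noteq> 0"
    and alpha_bar: "\<And>k. is_arg_min (\<lambda>a. (norm (fhat g m x j k a))\<^sup>2)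
      (\<lambda>a. a \<in> coeff_space (min m k)) (alpha_bar k)"
    and "M > 0"
    and bounded: "\<forall>\<^sub>F k in sequentially. coeff_infnorm (min m k) (alpha_bar k) \<le> M"
    and theta: "\<And>k. theta k =
      norm (fhat g m x j k (alpha_bar k)) / norm (residual g (x (j k 0)))"
  shows "\<exists>e :: nat \<Rightarrow> nat \<Rightarrow> real.
      (\<forall>i\<in>{0..m}. (\<lambda>k. e i k) \<in> O(\<lambda>k. (norm (residual g (x (k - i))))\<^sup>2)) \<and>
      (\<forall>\<^sub>F k in sequentially. norm (residual g (x (k + 1))) \<le>
         kappa * theta k * norm (residual g (x (j k 0))) + (\<Sum>i=0..m. e i k))"
proof -
  interpret lm_aa g m mu0 p1 p2 eta1 eta2 c gamma x mu j alpha r ared pred rho by (rule run)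
  have kappa: "0 \<le> kappa" using lipschitz by (rule lipschitz_on_nonneg)
  have nz: "F k \<noteq> 0" for k using no_termination by simp
  have F0: "F \<longlonglongrightarrow> 0" using F_tendsto_0 [OF lipschitz \<open>kappa < 1\<close> nz] .
  have L2_bar: "\<forall>\<^sub>F k in sequentially. L2_set (alpha_bar k) {1..min m k} \<le> real m * M"
    using bounded
  proof eventually_elim
    case (elim k)
    have "real (min m k) * coeff_infnorm (min m k) (alpha_bar k) \<le> real m * M"
      using elim \<open>M > 0\<close> by (intro mult_mono') (auto simp: coeff_infnorm_def)
    then show ?case using L2_set_le_coeff_infnorm [of "alpha_bar k" "min m k"] by linarith
  qed
  then have alpha_bound: "\<forall>\<^sub>F k in sequentially. \<forall>i\<in>{1..min m k}. \<bar>alpha k i\<bar> \<le> real m * M"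
  proof eventually_elim
    case (elim k)
    have "\<bar>alpha k i\<bar> \<le> real m * M" if "i \<in> {1..min m k}" for i
      using abs_le_L2_set [OF finite_atLeastAtMost that, of "alpha k"]
        L2_set_alpha_le [OF alpha_bar [of k] nz] elim by linarith
    then show ?case by blast
  qed
  obtain C where C: "0 \<le> C"
    "\<forall>\<^sub>F k in sequentially. norm (residual g (ghat g m x j k (alpha k)))
      \<le> kappa * norm (fhat g m x j k (alpha k)) + C * (window_max k)\<^sup>2"
    using residual_ghat_expansion [OF lipschitz \<open>kappa < 1\<close> fixpoint
        has_derivative_linear [OF deriv] expansion F0 _ alpha_bound] \<open>M > 0\<close> by auto
  have rho_gt: "\<forall>\<^sub>F k in sequentially. p2 < rho k"
    using eventually_rho_gt_p2 [OF F0 nz \<open>kappa \<le> c\<close> C] .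
  then obtain b where b: "\<forall>\<^sub>F k in sequentially. mu k \<le> b"
    by (rule eventually_mu_bounded)
  \<comment> \<open>\<open>C\<close> comes from expanding \<open>g\<close>, the other summand from
    the regularization penalty with \<open>mu k \<le> b\<close> and coefficient length at most
    \<open>m * M\<close>.\<close>
  define C' where "C' = C + kappa * (sqrt b * (real m * M))"
  have "\<forall>\<^sub>F k in sequentially. F (k + 1) \<le>
      kappa * theta k * F (j k 0) + (\<Sum>i=0..m. C' * (F (k - i))\<^sup>2)"
    using L2_bar C(2) rho_gt b eventually_ge_at_top [of m]
  proof eventually_elim
    case (elim k)
    have "0 \<le> b" using elim(4) mu_pos [of k] by simp
    have F_W: "(F (j k 0))\<^sup>2 \<le> (window_max k)\<^sup>2"
      by (intro power_mono F_le_window_max j_in_window) auto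
    have "sqrt (mu k) * (F (j k 0))\<^sup>2 * L2_set (alpha_bar k) {1..min m k}
        \<le> sqrt b * (window_max k)\<^sup>2 * (real m * M)"
      using elim(1,4) F_W \<open>0 \<le> b\<close> mu_pos [of k] by (intro mult_mono) auto
    moreover have "alpha_bar k \<in> coeff_space (min m k)"
      using alpha_bar [of k] by (simp add: is_arg_min_def)
    moreover have "theta k * F (j k 0) = norm (fhat g m x j k (alpha_bar k))"
      using nz [of "j k 0"] by (simp add: theta)
    ultimately have "norm (fhat g m x j k (alpha k))
        \<le> theta k * F (j k 0) + sqrt b * (window_max k)\<^sup>2 * (real m * M)"
      using fhat_alpha_le_fhat [of "alpha_bar k" k] by linarith
    then have "kappa * norm (fhat g m x j k (alpha k))
        \<le> kappa * (theta k * F (j k 0) + sqrt b * (window_max k)\<^sup>2 * (real m * M))"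
      using kappa by (rule mult_left_mono)
    \<comment> \<open>\<open>rho k > p2 > p1\<close> makes the step successful, so the new iterate
      is \<open>ghat\<close>.\<close>
    moreover have "F (k + 1) = norm (residual g (ghat g m x j k (alpha k)))"
      using elim(3) p by (simp add: x_Suc)
    ultimately have "F (k + 1) \<le> kappa * theta k * F (j k 0) + C' * (window_max k)\<^sup>2"
      using elim(2) by (simp add: C'_def algebra_simps)
    also have "C' * (window_max k)\<^sup>2 \<le> C' * (\<Sum>i=0..m. (F (k - i))\<^sup>2)"
      using window_max_square_le [OF elim(5)] C(1) kappa \<open>M > 0\<close> \<open>0 \<le> b\<close>
      by (intro mult_left_mono) (auto simp: C'_def)
    finally show ?case by (simp add: sum_distrib_left)
  qed
  then show ?thesis
    \<comment> \<open>Every error term carries the same \<open>C'\<close>, which does not depend on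
      \<open>k\<close>.\<close>
    by (intro exI [of _ "\<lambda>i k. C' * (F (k - i))\<^sup>2"]) auto
qed

end
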